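(* On $\mathbb R$ with Lebesgue measure, let $A(t)=B(t)=t^2\log(e+t)^2$. For integers $n\ge2$ let $K_n=n^2\log(e+n)^{-3}$, $I_n=(e^n+n-1,\,e^n+n)$, $J_n=(e^n,\,e^n+1)$, and define $$u(x)=\sum_{n\ge2}K_n\chi_{I_n}(x),\qquad \sigma(x)=\sum_{n\ge2}\chi_{J_n}(x).$$ Then the pair $(u,\sigma)$ satisfies the separated bump conditions $$\sup_Q\|u^{1/2}\|_{A,Q}\,\|\sigma^{1/2}\|_{2,Q}<\infty,\qquad \sup_Q\|u^{1/2}\|_{2,Q}\,\|\sigma^{1/2}\|_{B,Q}<\infty,$$ but fails the double bump condition: $$\sup_Q\|u^{1/2}\|_{A,Q}\,\|\sigma^{1/2}\|_{B,Q}=\infty,$$ where the suprema are over all bounded intervals $Q\subset\mathbb R$.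
   Context: For a Young function $A$ (continuous, convex, increasing on $[0,\infty)$, $A(0)=0$, $A(t)/t\to\infty$) and a bounded interval $Q$ of positive length, $\|v\|_{A,Q}=\inf\{\lambda>0:\frac1{|Q|}\int_Q A(|v(x)|/\lambda)\,dx\le1\}$ and $\|v\|_{2,Q}=\left(\frac1{|Q|}\int_Q|v|^2\,dx\right)^{1/2}$. $\chi_E$ is the indicator function of $E$. *)

theory Defs
  imports "HOL-Analysis.Analysis"
begin

definition young_function :: "(real \<Rightarrow> real) \<Rightarrow> bool" where
  "young_function A \<longleftrightarrow>
     continuous_on {0..} A \<and> convex_on {0..} A \<and> strict_mono_on {0..} A \<and> A 0 = 0 \<and>
     filterlim (\<lambda>t. A t / t) at_top at_top"

text \<open>Intervals may be open, closed or half-open.\<close>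

definition bounded_intervals :: "real set set" where
  "bounded_intervals = {Q. is_interval Q \<and> bounded Q \<and> 0 < measure lborel Q}"

text \<open>
  Averages and norms take values in \<^typ>\<open>ennreal\<close>, so that a divergent integral gives
  \<open>\<infinity>\<close>, and the infimum of an empty set of admissible \<open>l\<close> is \<open>\<infinity>\<close>.
\<close>

definition average :: "real set \<Rightarrow> (real \<Rightarrow> ennreal) \<Rightarrow> ennreal" where
  "average Q f = (\<integral>\<^sup>+x\<in>Q. f x \<partial>lborel) / emeasure lborel Q"

definition luxemburg_norm :: "(real \<Rightarrow> real) \<Rightarrow> real set \<Rightarrow> (real \<Rightarrow> real) \<Rightarrow> ennreal" where
  "luxemburg_norm A Q v =
     (INF l \<in> {l::real. 0 < l \<and> average Q (\<lambda>x. ennreal (A (\<bar>v x\<bar> / l))) \<le> 1}. ennreal l)"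

definition ennreal_sqrt :: "ennreal \<Rightarrow> ennreal" where
  "ennreal_sqrt a = (if a = \<infinity> then \<infinity> else ennreal (sqrt (enn2real a)))"

definition avg_L2_norm :: "real set \<Rightarrow> (real \<Rightarrow> real) \<Rightarrow> ennreal" where
  "avg_L2_norm Q v = ennreal_sqrt (average Q (\<lambda>x. ennreal (\<bar>v x\<bar>\<^sup>2)))"

lemma young_function_log_bump:
  assumes A: "\<And>t. 0 \<le> t \<Longrightarrow> A t = t\<^sup>2 * (ln (exp 1 + t))\<^sup>2"
  shows "young_function A"
proof -
  define g where "g = (\<lambda>t::real. t * ln (exp 1 + t))"
  have pos: "exp 1 + t > 0" if "t \<ge> 0" for t :: real
    using that by (simp add: add_pos_nonneg)
  have ln1: "ln (exp 1 + t) \<ge> 1" if "t \<ge> 0" for t :: real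
    using ln_ge_iff pos that by auto
  have Ag: "A t = g t * g t" if "t \<ge> 0" for t
    using A[OF that] by (simp add: g_def power2_eq_square)
  have g_nonneg: "g t \<ge> 0" if "t \<ge> 0" for t
    using ln1[OF that] that by (simp add: g_def)
  have g_less: "g s < g t" if "0 \<le> s" "s < t" for s t
  proof -
    have "s * ln (exp 1 + s) \<le> s * ln (exp 1 + t)"
      using that pos[of s] by (intro mult_left_mono) auto
    also have "\<dots> < t * ln (exp 1 + t)"
      using that ln1[of t] by (intro mult_strict_right_mono) auto
    finally show ?thesis by (simp add: g_def)
  qed
  have g_mono: "mono_on {0..} g"
    by (rule mono_onI) (metis atLeast_iff g_less order_le_less)
  have g_convex: "convex_on {0..} g"
  proof (rule f''_ge0_imp_convex)
    show "(g has_real_derivative (ln (exp 1 + t) + t / (exp 1 + t))) (at t)" if "t \<in> {0..}" for t :: real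
      using pos[of t] that unfolding g_def by (auto intro!: derivative_eq_intros)
    show "((\<lambda>t. ln (exp 1 + t) + t / (exp 1 + t)) has_real_derivative
        (1 / (exp 1 + t) + exp 1 / (exp 1 + t)\<^sup>2)) (at t)" if "t \<in> {0..}" for t :: real
      using pos[of t] that
      by (auto intro!: derivative_eq_intros simp: power2_eq_square)
    show "0 \<le> 1 / (exp 1 + t) + exp 1 / (exp 1 + t)\<^sup>2" if "t \<in> {0..}" for t :: real
      using pos[of t] that by simp
  qed auto
  have "convex_on {0..} (\<lambda>t. g t * g t)"
    using g_convex g_mono g_nonneg by (intro convex_on_mul) auto
  then have "convex_on {0..} A"
    by (auto simp: convex_on_def Ag)
  moreover have "continuous_on {0..} (\<lambda>t. g t * g t)"
    unfolding g_def using pos by (intro continuous_intros) (auto simp: less_imp_neq[symmetric])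
  then have "continuous_on {0..} A"
    by (subst continuous_on_cong[OF refl, where g = "\<lambda>t. g t * g t"]) (auto simp: Ag)
  moreover have "strict_mono_on {0..} A"
  proof (rule strict_mono_onI)
    fix s t :: real assume "s \<in> {0..}" "t \<in> {0..}" "s < t"
    then show "A s < A t"
      using g_less[of s t] g_nonneg[of s] by (simp add: Ag mult_strict_mono)
  qed
  moreover have "A 0 = 0" using A[of 0] by simp
  moreover have "filterlim (\<lambda>t. A t / t) at_top at_top"
  proof (rule filterlim_at_top_mono[OF filterlim_ident])
    show "\<forall>\<^sub>F t in at_top. t \<le> A t / t"
      using eventually_gt_at_top[of 0]
    proof eventually_elim
      case (elim t)
      then have "1 \<le> (ln (exp 1 + t))\<^sup>2" using ln1[of t] by (simp add: one_le_power)
      then show ?case using elim by (simp add: A power2_eq_square field_simps)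
    qed
  qed
  ultimately show ?thesis by (simp add: young_function_def)
qed

end

theory Submission
  imports Defs
begin

text \<open>
  Write \<open>L r = ln (exp 1 + r)\<close>. For a function that is at most \<open>a\<close> and is supported on a part
  of \<open>Q\<close> of relative measure at most \<open>1 / r\<close>, the \<open>L\<^sup>2\<close> average is at most \<open>a / sqrt r\<close> and the
  bump norm is at most \<open>a * L r / sqrt r\<close> (lemma \<open>luxemburg_norm_log_bump_le\<close>): the bump costs one
  logarithm. If \<open>sqrt u\<close> is such a function with bound \<open>a\<close> and \<open>sqrt \<sigma>\<close> with bound 1, both
  separated products are therefore at most \<open>a * L r / r\<close>.

  It remains to bound \<open>a * L r / r\<close> uniformly over all intervals \<open>Q\<close> that meet both supports
  (lemma \<open>interval_parameters\<close>). The decisive intervals are those that join \<open>J n\<close> to \<open>I n\<close> and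
  meet no other unit interval. They have length at least about \<open>n\<close>, so \<open>r\<close> can be taken of order \<open>n\<close>, and
  \<open>a = sqrt (K n) = n * L n powr (- 3 / 2)\<close> makes the product of order \<open>L n powr (- 1 / 2)\<close>.
  All other intervals that meet both supports reach over an exponentially long gap and are harmless.

  The bound on the bump norm is sharp up to a constant when the function equals \<open>a\<close> on a set of
  relative measure \<open>1 / r\<close> (lemma \<open>luxemburg_norm_log_bump_ge\<close>). Hence on the interval spanned by
  \<open>J n\<close> and \<open>I n\<close> two bumps give a product of at least a constant times
  \<open>sqrt (K n) * (L n)\<^sup>2 / n = sqrt (L n)\<close>, which is unbounded. The exponent 3 in \<open>K n\<close> was chosen
  between 2, where one bump is just affordable, and 4, where two bumps are.
\<close>

section \<open>The logarithm\<close>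

lemma ln_exp1_add_ge_1: "0 \<le> t \<Longrightarrow> 1 \<le> ln (exp 1 + t)" for t :: real
  by (subst ln_ge_iff) (auto intro: add_pos_nonneg)

lemma ln_exp1_add_le: "0 \<le> t \<Longrightarrow> ln (exp 1 + t) \<le> 1 + t" for t :: real
proof -
  assume t: "0 \<le> t"
  have "exp 1 + t \<le> exp 1 * exp t"
  proof -
    have "exp 1 * (1 + t) \<le> exp 1 * exp t"
      by (intro mult_left_mono) (auto simp: exp_ge_add_one_self)
    moreover have "1 * t \<le> exp 1 * t"
      using t by (intro mult_right_mono) auto
    ultimately show ?thesis by (simp add: algebra_simps)
  qed
  then have "ln (exp 1 + t) \<le> ln (exp (1 + t))"
    using t by (intro ln_mono) (auto simp: exp_add intro: add_pos_nonneg)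
  then show ?thesis by simp
qed

lemma ln_exp1_add_mono: "0 \<le> s \<Longrightarrow> s \<le> t \<Longrightarrow> ln (exp 1 + s) \<le> ln (exp 1 + t)" for s t :: real
  by (intro ln_mono) (auto intro: add_pos_nonneg)

text \<open>Up to the factor \<open>k\<close>, the logarithm does not distinguish \<open>s\<close> from \<open>s ^ k\<close>.\<close>

lemma ln_exp1_add_power_le:
  fixes s :: real
  assumes "0 \<le> s" "0 < k"
  shows "ln (exp 1 + s ^ k) \<le> real k * ln (exp 1 + s)"
proof -
  have "exp 1 + s ^ k \<le> (exp 1 + s) ^ k"
    using \<open>0 < k\<close>
  proof (induction k rule: nat_induct_non_zero)
    case (Suc k)
    have "exp 1 * 1 \<le> (exp 1 :: real) * exp 1"
      by (intro mult_left_mono) auto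
    moreover have "0 \<le> s * exp 1" "0 \<le> exp 1 * s ^ k"
      using assms by auto
    ultimately have "exp 1 + s ^ Suc k \<le> exp 1 * exp 1 + s * exp 1 + exp 1 * s ^ k + s * s ^ k"
      unfolding power_Suc by linarith
    also have "\<dots> = (exp 1 + s) * (exp 1 + s ^ k)"
      by (simp add: distrib_left distrib_right)
    also have "\<dots> \<le> (exp 1 + s) * (exp 1 + s) ^ k"
      using Suc.IH assms by (intro mult_left_mono) (auto intro: add_nonneg_nonneg)
    finally show ?case by simp
  qed simp
  then have "ln (exp 1 + s ^ k) \<le> ln ((exp 1 + s) ^ k)"
    using assms by (intro ln_mono) (auto intro: add_pos_nonneg)
  also have "\<dots> = real k * ln (exp 1 + s)"
    using assms by (intro ln_realpow)
  finally show ?thesis .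
qed

lemma ln_exp1_add_le_sqrt:
  fixes r :: real
  assumes "1 \<le> r"
  shows "ln (exp 1 + r) \<le> 4 * sqrt r"
proof -
  have "1 \<le> sqrt r"
    using assms by simp
  moreover have "ln (exp 1 + r) \<le> 2 * ln (exp 1 + sqrt r)"
    using ln_exp1_add_power_le[of "sqrt r" 2] assms by simp
  moreover have "ln (exp 1 + sqrt r) \<le> 1 + sqrt r"
    using assms by (intro ln_exp1_add_le) auto
  ultimately show ?thesis
    by linarith
qed

section \<open>Averages and norms of functions with small support\<close>

lemma bounded_interval_sets:
  assumes "Q \<in> bounded_intervals"
  shows "Q \<in> sets lborel"
proof -
  have "is_interval Q"
    using assms by (simp add: bounded_intervals_def)
  then show ?thesis
    by (simp add: real_interval_borel_measurable)
qed

lemma bounded_interval_emeasure: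
  assumes "Q \<in> bounded_intervals"
  shows "emeasure lborel Q = ennreal (measure lborel Q)"
proof -
  have "emeasure lborel Q < \<infinity>"
    using assms by (intro emeasure_bounded_finite) (simp add: bounded_intervals_def)
  then show ?thesis
    by (intro emeasure_eq_ennreal_measure) simp
qed

lemma dist_le_interval_measure:
  assumes Q: "Q \<in> bounded_intervals" and "x \<in> Q" "y \<in> Q" "x \<le> y"
  shows "y - x \<le> measure lborel Q"
proof -
  have "is_interval Q"
    using Q by (simp add: bounded_intervals_def)
  then have "z \<in> Q" if "z \<in> {x..y}" for z
    using mem_is_interval_1_I[of Q x y z] assms(2,3) that by simp
  then have "{x..y} \<subseteq> Q"
    by (rule subsetI)
  then have "emeasure lborel {x..y} \<le> emeasure lborel Q"
    using bounded_interval_sets[OF Q] by (rule emeasure_mono)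
  then have "ennreal (y - x) \<le> ennreal (measure lborel Q)"
    using \<open>x \<le> y\<close> by (simp only: bounded_interval_emeasure[OF Q] emeasure_lborel_Icc)
  then show ?thesis
    by (simp add: ennreal_le_iff)
qed

lemma average_le:
  assumes Q: "Q \<in> bounded_intervals" and E: "E \<in> sets lborel" and "0 \<le> c" "0 < r"
    and le: "\<And>x. x \<in> Q \<Longrightarrow> f x \<le> ennreal c * indicator E x"
    and small: "emeasure lborel E \<le> ennreal (measure lborel Q / r)"
  shows "average Q f \<le> ennreal (c / r)"
proof -
  have pos: "0 < measure lborel Q"
    using Q by (simp add: bounded_intervals_def)
  have "(\<integral>\<^sup>+x\<in>Q. f x \<partial>lborel) \<le> (\<integral>\<^sup>+x. ennreal c * indicator E x \<partial>lborel)"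
  proof (rule nn_integral_mono)
    show "f x * indicator Q x \<le> ennreal c * indicator E x" for x
      using le[of x] by (cases "x \<in> Q") auto
  qed
  also have "\<dots> = ennreal c * emeasure lborel E"
    using E by (rule nn_integral_cmult_indicator)
  also have "\<dots> \<le> ennreal c * ennreal (measure lborel Q / r)"
    using small by (rule mult_left_mono) simp
  also have "\<dots> = ennreal (c * (measure lborel Q / r))"
    using assms by (simp add: ennreal_mult del: times_divide_eq_right)
  finally have "average Q f \<le> ennreal (c * (measure lborel Q / r)) / ennreal (measure lborel Q)"
    unfolding average_def bounded_interval_emeasure[OF Q] by (rule divide_right_mono_ennreal)
  also have "\<dots> = ennreal (c / r)"
    using assms pos by (subst divide_ennreal) (auto simp: field_simps)
  finally show ?thesis .
qed

lemma average_ge: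
  assumes Q: "Q \<in> bounded_intervals" and E: "E \<in> sets lborel" "E \<subseteq> Q" "emeasure lborel E = 1"
    and "0 \<le> c" and ge: "\<And>x. x \<in> E \<Longrightarrow> ennreal c \<le> f x"
  shows "ennreal (c / measure lborel Q) \<le> average Q f"
proof -
  have pos: "0 < measure lborel Q"
    using Q by (simp add: bounded_intervals_def)
  have "ennreal c = (\<integral>\<^sup>+x. ennreal c * indicator E x \<partial>lborel)"
    using E by (subst nn_integral_cmult_indicator) auto
  also have "\<dots> \<le> (\<integral>\<^sup>+x\<in>Q. f x \<partial>lborel)"
    using ge E by (intro nn_integral_mono) (auto simp: indicator_def)
  finally have "ennreal c / ennreal (measure lborel Q) \<le> average Q f"
    unfolding average_def bounded_interval_emeasure[OF Q] by (rule divide_right_mono_ennreal)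
  then show ?thesis
    using pos \<open>0 \<le> c\<close> by (simp add: divide_ennreal)
qed

lemma luxemburg_norm_zero:
  assumes "A 0 = 0" and zero: "\<And>x. x \<in> Q \<Longrightarrow> v x = 0"
  shows "luxemburg_norm A Q v = 0"
proof -
  have "(\<integral>\<^sup>+x\<in>Q. ennreal (A (\<bar>v x\<bar> / l)) \<partial>lborel) = (\<integral>\<^sup>+(x::real). 0 \<partial>lborel)" for l
  proof (rule nn_integral_cong)
    show "ennreal (A (\<bar>v x\<bar> / l)) * indicator Q x = 0" for x
      using assms by (cases "x \<in> Q") auto
  qed
  then have avg: "average Q (\<lambda>x. ennreal (A (\<bar>v x\<bar> / l))) = 0" for l
    by (simp add: average_def)
  have "luxemburg_norm A Q v \<le> 0 + ennreal e" if "0 < e" for e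
    unfolding luxemburg_norm_def add_0 using that avg by (intro INF_lower) auto
  then have "luxemburg_norm A Q v \<le> 0"
    by (rule ennreal_le_epsilon)
  then show ?thesis by simp
qed

lemma avg_L2_norm_zero:
  assumes zero: "\<And>x. x \<in> Q \<Longrightarrow> v x = 0"
  shows "avg_L2_norm Q v = 0"
proof -
  have "(\<integral>\<^sup>+x\<in>Q. ennreal (\<bar>v x\<bar>\<^sup>2) \<partial>lborel) = (\<integral>\<^sup>+(x::real). 0 \<partial>lborel)"
  proof (rule nn_integral_cong)
    show "ennreal (\<bar>v x\<bar>\<^sup>2) * indicator Q x = 0" for x
      using assms by (cases "x \<in> Q") auto
  qed
  then show ?thesis
    by (simp add: avg_L2_norm_def average_def ennreal_sqrt_def)
qed

lemma avg_L2_norm_le: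
  assumes Q: "Q \<in> bounded_intervals" and E: "E \<in> sets lborel" and "0 \<le> a" "0 < r"
    and bound: "\<And>x. x \<in> Q \<Longrightarrow> \<bar>v x\<bar> \<le> a * indicator E x"
    and small: "emeasure lborel E \<le> ennreal (measure lborel Q / r)"
  shows "avg_L2_norm Q v \<le> ennreal (a / sqrt r)"
proof -
  have le: "average Q (\<lambda>x. ennreal (\<bar>v x\<bar>\<^sup>2)) \<le> ennreal (a\<^sup>2 / r)"
  proof (rule average_le[OF Q E _ \<open>0 < r\<close> _ small])
    show "ennreal (\<bar>v x\<bar>\<^sup>2) \<le> ennreal (a\<^sup>2) * indicator E x" if "x \<in> Q" for x
      using power_mono[OF bound[OF that], of 2] by (cases "x \<in> E") (auto intro: ennreal_leI)
  qed simp
  then have "average Q (\<lambda>x. ennreal (\<bar>v x\<bar>\<^sup>2)) \<noteq> \<infinity>"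
    by (auto simp: top_unique)
  moreover have "enn2real (average Q (\<lambda>x. ennreal (\<bar>v x\<bar>\<^sup>2))) \<le> a\<^sup>2 / r"
    using le \<open>0 < r\<close> by (intro enn2real_leI) auto
  then have "sqrt (enn2real (average Q (\<lambda>x. ennreal (\<bar>v x\<bar>\<^sup>2)))) \<le> a / sqrt r"
    using real_sqrt_le_mono[of _ "a\<^sup>2 / r"] \<open>0 \<le> a\<close> by (simp add: real_sqrt_divide)
  ultimately show ?thesis
    by (simp add: avg_L2_norm_def ennreal_sqrt_def ennreal_leI)
qed

text \<open>
  The level \<open>l = a * ln (exp 1 + r) / sqrt r\<close> is admissible because
  \<open>a / l = sqrt r / ln (exp 1 + r)\<close> is at most \<open>r\<close>, so that the logarithm inside \<open>A (a / l)\<close>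
  is at most \<open>ln (exp 1 + r)\<close> and \<open>A (a / l) \<le> r\<close>.
\<close>

lemma luxemburg_norm_log_bump_le:
  assumes A: "\<And>t. 0 \<le> t \<Longrightarrow> A t = t\<^sup>2 * (ln (exp 1 + t))\<^sup>2"
    and Q: "Q \<in> bounded_intervals" and E: "E \<in> sets lborel" and "0 < a" "1 \<le> r"
    and bound: "\<And>x. x \<in> Q \<Longrightarrow> \<bar>v x\<bar> \<le> a * indicator E x"
    and small: "emeasure lborel E \<le> ennreal (measure lborel Q / r)"
  shows "luxemburg_norm A Q v \<le> ennreal (a * ln (exp 1 + r) / sqrt r)"
proof -
  define L where "L = ln (exp 1 + r)"
  define l where "l = a * L / sqrt r"
  have L1: "1 \<le> L"
    using assms by (simp add: L_def ln_exp1_add_ge_1)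
  then have l0: "0 < l"
    using assms by (simp add: l_def)
  have A_le: "A (\<bar>v x\<bar> / l) \<le> r" if "x \<in> Q" for x
  proof -
    have s: "\<bar>v x\<bar> / l \<le> sqrt r / L"
    proof -
      have "\<bar>v x\<bar> \<le> a"
        using bound[OF that] \<open>0 < a\<close> by (cases "x \<in> E") auto
      then have "\<bar>v x\<bar> / l \<le> a / l"
        using l0 by (simp add: divide_right_mono)
      then show ?thesis
        using assms by (simp add: l_def)
    qed
    have "sqrt r / L \<le> sqrt r"
      using L1 assms by (simp add: divide_le_eq mult_le_cancel_left1)
    also have "\<dots> \<le> r"
      using \<open>1 \<le> r\<close> by (simp add: real_le_lsqrt power2_eq_square)
    finally have "ln (exp 1 + \<bar>v x\<bar> / l) \<le> L"
      unfolding L_def using s l0 by (intro ln_exp1_add_mono) (auto simp: L_def)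
    moreover have "0 \<le> ln (exp 1 + \<bar>v x\<bar> / l)"
      using ln_exp1_add_ge_1[of "\<bar>v x\<bar> / l"] l0 by simp
    ultimately have "A (\<bar>v x\<bar> / l) \<le> (sqrt r / L)\<^sup>2 * L\<^sup>2"
      using s l0 by (subst A) (auto intro!: mult_mono power_mono)
    also have "\<dots> = r"
      using L1 assms by (simp add: power_divide)
    finally show ?thesis .
  qed
  have "average Q (\<lambda>x. ennreal (A (\<bar>v x\<bar> / l))) \<le> ennreal (r / r)"
  proof (rule average_le[OF Q E _ _ _ small])
    show "ennreal (A (\<bar>v x\<bar> / l)) \<le> ennreal r * indicator E x" if "x \<in> Q" for x
    proof (cases "x \<in> E")
      case True
      then show ?thesis using A_le[OF that] by (simp add: ennreal_leI)
    next
      case False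
      then show ?thesis using bound[OF that] A[of 0] by simp
    qed
  qed (use assms in auto)
  then show ?thesis
    unfolding luxemburg_norm_def using l0 assms
    by (intro INF_lower) (auto simp: l_def L_def)
qed

text \<open>
  The inverse of \<open>A\<close> is at most \<open>8 * sqrt r / ln (exp 1 + r)\<close>: a value \<open>t\<close> below the fourth root
  of \<open>r\<close> satisfies this bound because the logarithm is smaller than that root, and for larger \<open>t\<close>
  the logarithm inside \<open>A t\<close> is at least a quarter of \<open>ln (exp 1 + r)\<close>.
\<close>

lemma log_bump_inverse_le:
  fixes r t :: real
  assumes "1 \<le> r" "0 \<le> t" and le: "t\<^sup>2 * (ln (exp 1 + t))\<^sup>2 \<le> r"
  shows "t * ln (exp 1 + r) \<le> 8 * sqrt r"
proof -
  define s where "s = sqrt (sqrt r)"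
  have s2: "s ^ 2 = sqrt r"
    using assms by (simp add: s_def)
  have s4: "s ^ 4 = r"
    using power_mult[of s 2 2] assms by (simp add: s2)
  have s1: "1 \<le> s"
    using assms by (simp add: s_def)
  have L4: "ln (exp 1 + r) \<le> 4 * ln (exp 1 + s)"
    using ln_exp1_add_power_le[of s 4] s1 s4 by simp
  show ?thesis
  proof (cases "t \<le> s")
    case True
    have "ln (exp 1 + r) \<le> 8 * s"
      using L4 ln_exp1_add_le[of s] s1 by simp
    then have "t * ln (exp 1 + r) \<le> s * (8 * s)"
      using True s1 assms ln_exp1_add_ge_1[of r] by (intro mult_mono) auto
    then show ?thesis
      using s2 by (simp add: power2_eq_square)
  next
    case False
    have "(t * ln (exp 1 + t))\<^sup>2 \<le> r"
      using le by (simp add: power_mult_distrib)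
    then have "t * ln (exp 1 + t) \<le> sqrt r"
      by (rule real_le_rsqrt)
    moreover have "ln (exp 1 + r) \<le> 4 * ln (exp 1 + t)"
      using L4 ln_exp1_add_mono[of s t] s1 False by simp
    then have "t * ln (exp 1 + r) \<le> t * (4 * ln (exp 1 + t))"
      using \<open>0 \<le> t\<close> by (rule mult_left_mono)
    moreover have "0 \<le> sqrt r"
      using assms by simp
    ultimately show ?thesis
      by linarith
  qed
qed

lemma luxemburg_norm_log_bump_ge:
  assumes A: "\<And>t. 0 \<le> t \<Longrightarrow> A t = t\<^sup>2 * (ln (exp 1 + t))\<^sup>2"
    and Q: "Q \<in> bounded_intervals" "1 \<le> measure lborel Q"
    and E: "E \<in> sets lborel" "E \<subseteq> Q" "emeasure lborel E = 1"
    and "0 \<le> a" and v: "\<And>x. x \<in> E \<Longrightarrow> v x = a"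
  shows "ennreal (a * ln (exp 1 + measure lborel Q) / (8 * sqrt (measure lborel Q)))
    \<le> luxemburg_norm A Q v"
  unfolding luxemburg_norm_def
proof (rule INF_greatest)
  fix l assume "l \<in> {l. 0 < l \<and> average Q (\<lambda>x. ennreal (A (\<bar>v x\<bar> / l))) \<le> 1}"
  then have l: "0 < l" "average Q (\<lambda>x. ennreal (A (\<bar>v x\<bar> / l))) \<le> 1" by auto
  have A0: "0 \<le> A (a / l)"
    using l \<open>0 \<le> a\<close> by (simp add: A)
  have "ennreal (A (a / l) / measure lborel Q) \<le> average Q (\<lambda>x. ennreal (A (\<bar>v x\<bar> / l)))"
    using v \<open>0 \<le> a\<close> by (intro average_ge[OF Q(1) E A0]) auto
  also have "\<dots> \<le> ennreal 1"
    using l by simp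
  finally have "A (a / l) / measure lborel Q \<le> 1"
    by (subst (asm) ennreal_le_iff) auto
  then have "A (a / l) \<le> measure lborel Q"
    using Q by simp
  then have "a / l * ln (exp 1 + measure lborel Q) \<le> 8 * sqrt (measure lborel Q)"
    using l \<open>0 \<le> a\<close> Q by (intro log_bump_inverse_le) (auto simp: A)
  then show "ennreal (a * ln (exp 1 + measure lborel Q) / (8 * sqrt (measure lborel Q))) \<le> ennreal l"
    using l Q by (intro ennreal_leI) (simp add: field_simps)
qed

section \<open>The blocks\<close>

text \<open>
  The \<open>n\<close>-th block is the hull of \<open>J n\<close> and \<open>I n\<close>. For an interval that meets several blocks, only
  their exponential separation matters; the gap between \<open>J n\<close> and \<open>I n\<close> inside a block
  matters for an interval that meets a single one.
\<close>

definition block :: "nat \<Rightarrow> real set" where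
  "block n = {exp (real n) <..< exp (real n) + real n}"

lemma block_gap:
  assumes "1 \<le> m" "m < n"
  shows "exp (real m) + real m \<le> exp (real n)"
    "real n ^ 3 / 9 \<le> exp (real n) - (exp (real m) + real m)"
proof -
  define x where "x = real n - 1"
  have x1: "1 \<le> x" and mx: "real m \<le> x"
    using assms by (auto simp: x_def)
  \<comment> \<open>The quadratic Taylor bound at \<open>x / 2\<close>, squared, supplies the cubic term.\<close>
  have "1 + x / 2 + (x / 2)\<^sup>2 / 2 \<le> exp (x / 2)"
    using x1 by (intro exp_lower_Taylor_quadratic) auto
  then have "(1 + x / 2 + (x / 2)\<^sup>2 / 2)\<^sup>2 \<le> exp (x / 2) ^ 2"
    using x1 by (intro power_mono) auto
  also have "exp (x / 2) ^ 2 = exp x"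
    by (simp add: exp_double[symmetric])
  finally have "1 + x + x ^ 2 / 2 + x ^ 3 / 8 + x ^ 4 / 64 \<le> exp x"
    by (simp add: power2_eq_square power3_eq_cube power4_eq_xxxx algebra_simps)
  then have ex: "1 + x + x ^ 2 / 2 + x ^ 3 / 8 \<le> exp x"
    using x1 zero_le_power[of x 4] by linarith
  have "exp (x + 1) \<ge> 2 * exp x"
    using exp_ge_add_one_self[of 1] by (simp add: exp_add)
  then have "2 * exp x \<le> exp (real n)"
    by (simp add: x_def)
  moreover have "exp (real m) \<le> exp x"
    using mx by simp
  ultimately have gap: "1 + x ^ 2 / 2 + x ^ 3 / 8 \<le> exp (real n) - (exp (real m) + real m)"
    using ex mx by linarith
  have cubic: "(x + 1) ^ 3 / 9 \<le> 1 + x ^ 2 / 2 + x ^ 3 / 8"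
  proof -
    have "0 \<le> (x - 1)\<^sup>2" "0 \<le> x ^ 3" using x1 by auto
    then show ?thesis by (simp add: power2_eq_square power3_eq_cube algebra_simps)
  qed
  show "real n ^ 3 / 9 \<le> exp (real n) - (exp (real m) + real m)"
    using gap cubic by (simp add: x_def)
  then show "exp (real m) + real m \<le> exp (real n)"
    using zero_le_power[of "real n" 3] by linarith
qed

lemma block_disjoint:
  assumes "1 \<le> m" "1 \<le> n" "x \<in> block m" "x \<in> block n"
  shows "m = n"
  using assms block_gap(1)[of m n] block_gap(1)[of n m]
  by (cases m n rule: linorder_cases) (auto simp: block_def)

lemma block_sum_value:
  assumes S: "\<And>n. 2 \<le> n \<Longrightarrow> S n \<subseteq> block n" and "2 \<le> n" "x \<in> S n"
  shows "(\<Sum>\<^sub>\<infinity>n\<in>{2..}. c n * indicator (S n) x) = (c n :: real)"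
proof -
  have other: "x \<notin> S m" if "2 \<le> m" "m \<noteq> n" for m
    using block_disjoint[of m n x] S[of m] S[of n] assms that by auto
  have "(\<Sum>\<^sub>\<infinity>m\<in>{2..}. c m * indicator (S m) x) = (\<Sum>\<^sub>\<infinity>m\<in>{n}. c m * indicator (S m) x)"
    using assms other by (intro infsum_cong_neutral) auto
  then show ?thesis using assms by simp
qed

lemma block_sum_support:
  assumes "(\<Sum>\<^sub>\<infinity>n\<in>{2..}. c n * indicator (S n) x) \<noteq> (0 :: real)"
  shows "\<exists>n\<ge>2. x \<in> S n"
proof (rule ccontr)
  assume "\<not> ?thesis"
  then have "(\<Sum>\<^sub>\<infinity>n\<in>{2..}. c n * indicator (S n) x) = 0"
    by (intro infsum_0) auto
  with assms show False by simp
qed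

lemma finite_blocks_met:
  assumes "bounded Q"
  shows "finite {n. Q \<inter> block n \<noteq> {}}"
proof -
  obtain b where b: "\<And>x. x \<in> Q \<Longrightarrow> \<bar>x\<bar> \<le> b"
    using assms by (auto simp: bounded_iff)
  have "{n. Q \<inter> block n \<noteq> {}} \<subseteq> {n. real n \<le> b}"
  proof clarify
    fix n assume "Q \<inter> block n \<noteq> {}"
    then obtain x where "x \<in> Q" "x \<in> block n"
      by blast
    then show "real n \<le> b"
      using b[of x] exp_ge_add_one_self[of "real n"] unfolding block_def greaterThanLessThan_iff
      by linarith
  qed
  moreover have "finite {n. real n \<le> b}"
    by (rule finite_subset[of _ "{..nat \<lfloor>b\<rfloor>}"]) (auto simp: le_nat_floor)
  ultimately show ?thesis by (rule finite_subset)
qed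

lemma emeasure_Int_Union_le:
  assumes "finite M" and S: "\<And>n. n \<in> M \<Longrightarrow> S n \<in> sets lborel \<and> emeasure lborel (S n) \<le> 1"
    and Q: "Q \<in> sets lborel"
  shows "emeasure lborel (Q \<inter> (\<Union>n\<in>M. S n)) \<le> ennreal (real (card M))"
proof -
  have "emeasure lborel (Q \<inter> (\<Union>n\<in>M. S n)) \<le> emeasure lborel (\<Union>n\<in>M. S n)"
    using S \<open>finite M\<close> by (intro emeasure_mono) auto
  also have "\<dots> \<le> (\<Sum>n\<in>M. emeasure lborel (S n))"
    using S \<open>finite M\<close> by (intro emeasure_subadditive_finite) auto
  also have "\<dots> \<le> (\<Sum>n\<in>M. 1)"
    using S by (intro sum_mono) auto
  finally show ?thesis by (simp add: ennreal_of_nat_eq_real_of_nat)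
qed

section \<open>Intervals meeting the supports of both weights\<close>

lemma K_bounds:
  assumes K: "\<And>n. 2 \<le> n \<Longrightarrow> K n = (real n)\<^sup>2 * ln (exp 1 + real n) powi (-3)" and "2 \<le> n"
  shows "0 \<le> K n" "K n \<le> (real n / ln (exp 1 + real n))\<^sup>2" "K n \<le> (real n)\<^sup>2"
proof -
  define L where "L = ln (exp 1 + real n)"
  have L1: "1 \<le> L"
    by (simp add: L_def ln_exp1_add_ge_1)
  have Kn: "K n = (real n)\<^sup>2 / L ^ 3"
    using K[OF \<open>2 \<le> n\<close>] by (simp add: L_def power_int_minus divide_inverse)
  then show "0 \<le> K n"
    using L1 by simp
  have "(real n)\<^sup>2 / L ^ 3 \<le> (real n)\<^sup>2 / L\<^sup>2"
    using L1 by (intro divide_left_mono power_increasing) auto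
  then show 1: "K n \<le> (real n / ln (exp 1 + real n))\<^sup>2"
    by (simp add: Kn power_divide L_def)
  have "(real n / L)\<^sup>2 \<le> (real n)\<^sup>2"
    using L1 by (intro power_mono) (auto simp: divide_le_eq mult_le_cancel_left1)
  with 1 show "K n \<le> (real n)\<^sup>2"
    by (simp add: L_def)
qed

text \<open>
  If \<open>Q\<close> meets only the block \<open>N\<close>, then it contains the gap of length \<open>N - 2\<close> between \<open>J N\<close> and
  \<open>I N\<close>. Both weights then have supports of relative measure of order \<open>1 / N\<close> in \<open>Q\<close>, while
  \<open>sqrt u\<close> is at most \<open>N / ln (exp 1 + N)\<close>; this logarithm pays for the single bump.
  If \<open>Q\<close> meets several blocks, the last of them being \<open>N\<close>, then its length is exponential in
  \<open>N\<close>, and crude bounds are enough: \<open>sqrt u\<close> is at most \<open>N\<close>, and at most \<open>N\<close> unit intervals of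
  either kind are met.
\<close>

lemma interval_parameters:
  assumes K: "\<And>n. 2 \<le> n \<Longrightarrow> K n = (real n)\<^sup>2 * ln (exp 1 + real n) powi (-3)"
    and I: "\<And>n. 2 \<le> n \<Longrightarrow> I n = {exp (real n) + real n - 1 <..< exp (real n) + real n}"
    and J: "\<And>n. 2 \<le> n \<Longrightarrow> J n = {exp (real n) <..< exp (real n) + 1}"
    and Q: "Q \<in> bounded_intervals"
    and x: "2 \<le> i" "x \<in> Q" "x \<in> I i"
    and y: "2 \<le> j" "y \<in> Q" "y \<in> J j"
  obtains a r M where "0 < a" "1 \<le> r" "a * ln (exp 1 + r) / r \<le> 12"
    "finite M" "M = {n. 2 \<le> n \<and> Q \<inter> block n \<noteq> {}}" "\<And>n. n \<in> M \<Longrightarrow> K n \<le> a\<^sup>2"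
    "emeasure lborel (Q \<inter> (\<Union>n\<in>M. I n)) \<le> ennreal (measure lborel Q / r)"
    "emeasure lborel (Q \<inter> (\<Union>n\<in>M. J n)) \<le> ennreal (measure lborel Q / r)"
proof -
  define M where "M = {n. 2 \<le> n \<and> Q \<inter> block n \<noteq> {}}"
  define N where "N = Max M"
  have finM: "finite M"
    by (rule finite_subset[OF _ finite_blocks_met[of Q]])
      (use Q in \<open>auto simp: M_def bounded_intervals_def\<close>)
  have iM: "i \<in> M"
    using x by (auto simp: M_def block_def I)
  have jM: "j \<in> M"
    using y by (auto simp: M_def block_def J)
  have NM: "N \<in> M" and leN: "\<And>n. n \<in> M \<Longrightarrow> n \<le> N"
    using finM iM by (auto simp: N_def intro: Max_in)
  have N2: "2 \<le> N"
    using NM by (simp add: M_def)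
  have unit: "S n \<in> sets lborel \<and> emeasure lborel (S n) \<le> 1" if "n \<in> M" "S \<in> {I, J}" for S n
    using that by (auto simp: M_def I J)
  have small: "emeasure lborel (Q \<inter> (\<Union>n\<in>M. S n)) \<le> ennreal (real (card M))" if "S \<in> {I, J}" for S
    using that unit by (intro emeasure_Int_Union_le finM bounded_interval_sets[OF Q]) auto
  have in_Q: "emeasure lborel (Q \<inter> Z) \<le> ennreal (measure lborel Q)" for Z
    using emeasure_mono[of "Q \<inter> Z" Q lborel] bounded_interval_sets[OF Q]
    by (simp add: bounded_interval_emeasure[OF Q])
  show ?thesis
  proof (cases "M = {N}")
    case True
    define L where "L = ln (exp 1 + real N)"
    \<comment> \<open>For \<open>N = 2\<close> the gap is empty and for \<open>N = 3\<close> it has length 1; there the trivial relative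
      measure 1 is enough.\<close>
    define r where "r = max 1 (real N - 2)"
    have L1: "1 \<le> L"
      by (simp add: L_def ln_exp1_add_ge_1)
    have r: "1 \<le> r" "r \<le> real N" "real N \<le> 3 * r"
      using N2 by (auto simp: r_def max_def)
    have ij: "i = N" "j = N"
      using True iM jM by auto
    have meas: "emeasure lborel (Q \<inter> (\<Union>n\<in>M. S n)) \<le> ennreal (measure lborel Q / r)"
      if S: "S \<in> {I, J}" for S
    proof (cases "3 \<le> N")
      case False
      then show ?thesis
        using in_Q by (simp add: r_def)
    next
      case N3: True
      have "r \<le> x - y"
        using x y N3 by (auto simp: ij I J r_def)
      also have "\<dots> \<le> measure lborel Q"
        using x y \<open>r \<le> x - y\<close> r by (intro dist_le_interval_measure Q) auto
      finally have "1 \<le> measure lborel Q / r"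
        using r by simp
      then have "ennreal (real (card M)) \<le> ennreal (measure lborel Q / r)"
        using True by (intro ennreal_leI) simp
      with small[OF S] show ?thesis
        by (rule order_trans)
    qed
    have "(real N / L) * ln (exp 1 + r) / r \<le> (real N / L) * L / r"
      unfolding L_def using r L1
      by (intro divide_right_mono mult_left_mono ln_exp1_add_mono) (auto simp: L_def)
    also have "\<dots> \<le> 12"
      using r L1 by (simp add: divide_le_eq)
    finally have C: "(real N / L) * ln (exp 1 + r) / r \<le> 12" .
    have "K n \<le> (real N / L)\<^sup>2" if "n \<in> M" for n
      using that True K_bounds(2)[OF K N2] by (simp add: L_def)
    moreover have "0 < real N / L"
      using N2 L1 by simp
    ultimately show ?thesis
      using meas[of I] meas[of J] by (intro that[OF _ r(1) C finM M_def]) simp_all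
  next
    case False
    then obtain m where "m \<in> M" "m \<noteq> N"
      using NM by blast
    then have m: "m \<in> M" "m < N"
      using leN[of m] by auto
    \<comment> \<open>The divisor 9 is large enough for \<open>N * r\<close> to stay below the gap between the blocks, and
      small enough for \<open>r\<close> to be at least 1, as \<open>N\<close> is at least 3.\<close>
    define r where "r = (real N)\<^sup>2 / 9"
    have N3: "3 \<le> N"
      using m by (simp add: M_def)
    then have "3\<^sup>2 \<le> (real N)\<^sup>2"
      by (intro power_mono) auto
    then have r1: "1 \<le> r"
      by (simp add: r_def)
    have sqrt_r: "sqrt r = real N / 3"
      by (simp add: r_def real_sqrt_divide)
    obtain p q where pq: "p \<in> Q" "p \<in> block m" "q \<in> Q" "q \<in> block N"
      using m NM by (auto simp: M_def)
    have "real N ^ 3 / 9 \<le> q - p"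
      using block_gap(2)[of m N] m pq by (auto simp: M_def block_def)
    also have "\<dots> \<le> measure lborel Q"
      using pq block_gap(1)[of m N] m
      by (intro dist_le_interval_measure Q) (auto simp: M_def block_def)
    finally have Nr: "real N * r \<le> measure lborel Q"
      by (simp add: r_def power2_eq_square power3_eq_cube)
    have "1 \<le> n" if "n \<in> M" for n
      using that by (simp add: M_def)
    then have "M \<subseteq> {1..N}"
      using leN by auto
    then have "real (card M) \<le> real N"
      using card_mono[of "{1..N}" M] by simp
    also have "\<dots> \<le> measure lborel Q / r"
      using Nr r1 by (simp add: pos_le_divide_eq)
    finally have "ennreal (real (card M)) \<le> ennreal (measure lborel Q / r)"
      by (rule ennreal_leI)
    then have meas: "emeasure lborel (Q \<inter> (\<Union>n\<in>M. S n)) \<le> ennreal (measure lborel Q / r)"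
      if "S \<in> {I, J}" for S
      using small[OF that] by (rule order_trans[rotated])
    have "real N * ln (exp 1 + r) / r \<le> real N * (4 * sqrt r) / r"
      using r1 by (intro divide_right_mono mult_left_mono ln_exp1_add_le_sqrt) auto
    also have "\<dots> = 12"
      unfolding sqrt_r using N3 by (simp add: r_def power2_eq_square field_simps)
    finally have C: "real N * ln (exp 1 + r) / r \<le> 12" .
    have "K n \<le> (real N)\<^sup>2" if "n \<in> M" for n
    proof -
      have "K n \<le> (real n)\<^sup>2"
        using that by (intro K_bounds(3) K) (auto simp: M_def)
      also have "\<dots> \<le> (real N)\<^sup>2"
        using leN[OF that] by (intro power_mono) auto
      finally show ?thesis .
    qed
    moreover have "0 < real N"
      using N2 by simp
    ultimately show ?thesis
      using meas[of I] meas[of J] by (intro that[OF _ r1 C finM M_def]) simp_all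
  qed
qed

section \<open>Separated bumps without the double bump\<close>

theorem mainTheorem4:
  fixes A B :: "real \<Rightarrow> real"
    and K :: "nat \<Rightarrow> real"
    and I J :: "nat \<Rightarrow> real set"
    and u \<sigma> :: "real \<Rightarrow> real"
  assumes A: "\<And>t. 0 \<le> t \<Longrightarrow> A t = t\<^sup>2 * (ln (exp 1 + t))\<^sup>2"
    and B: "\<And>t. 0 \<le> t \<Longrightarrow> B t = t\<^sup>2 * (ln (exp 1 + t))\<^sup>2"
    and K: "\<And>n. 2 \<le> n \<Longrightarrow> K n = (real n)\<^sup>2 * ln (exp 1 + real n) powi (-3)"
    and I: "\<And>n. 2 \<le> n \<Longrightarrow> I n = {exp (real n) + real n - 1 <..< exp (real n) + real n}"
    and J: "\<And>n. 2 \<le> n \<Longrightarrow> J n = {exp (real n) <..< exp (real n) + 1}"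
    and u: "\<And>x. u x = (\<Sum>\<^sub>\<infinity>n\<in>{2..}. K n * indicator (I n) x)"
    and \<sigma>: "\<And>x. \<sigma> x = (\<Sum>\<^sub>\<infinity>n\<in>{2..}. indicator (J n) x)"
  shows "(SUP Q\<in>bounded_intervals.
            luxemburg_norm A Q (\<lambda>x. sqrt (u x)) * avg_L2_norm Q (\<lambda>x. sqrt (\<sigma> x))) < \<infinity>
       \<and> (SUP Q\<in>bounded_intervals.
            avg_L2_norm Q (\<lambda>x. sqrt (u x)) * luxemburg_norm B Q (\<lambda>x. sqrt (\<sigma> x))) < \<infinity>
       \<and> (SUP Q\<in>bounded_intervals.
            luxemburg_norm A Q (\<lambda>x. sqrt (u x)) * luxemburg_norm B Q (\<lambda>x. sqrt (\<sigma> x))) = \<infinity>"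
proof -
  have I_block: "I n \<subseteq> block n" if "2 \<le> n" for n
    using that by (auto simp: I block_def)
  have J_block: "J n \<subseteq> block n" if "2 \<le> n" for n
    using that by (auto simp: J block_def)
  have \<sigma>': "\<sigma> x = (\<Sum>\<^sub>\<infinity>n\<in>{2..}. 1 * indicator (J n) x)" for x
    by (simp add: \<sigma>)
  have u_val: "u x = K n" if "2 \<le> n" "x \<in> I n" for n x
    unfolding u by (rule block_sum_value[OF I_block that])
  have \<sigma>_val: "\<sigma> x = 1" if "2 \<le> n" "x \<in> J n" for n x
    unfolding \<sigma>' by (rule block_sum_value[OF J_block that])
  have u_supp: "\<exists>n\<ge>2. x \<in> I n" if "u x \<noteq> 0" for x
    using that unfolding u by (rule block_sum_support)
  have \<sigma>_supp: "\<exists>n\<ge>2. x \<in> J n" if "\<sigma> x \<noteq> 0" for x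
    using that unfolding \<sigma>' by (rule block_sum_support)
  have bounds:
    "luxemburg_norm A Q (\<lambda>x. sqrt (u x)) * avg_L2_norm Q (\<lambda>x. sqrt (\<sigma> x)) \<le> ennreal 12
     \<and> avg_L2_norm Q (\<lambda>x. sqrt (u x)) * luxemburg_norm B Q (\<lambda>x. sqrt (\<sigma> x)) \<le> ennreal 12"
    if Q: "Q \<in> bounded_intervals" for Q
  proof -
    \<comment> \<open>If a weight vanishes on \<open>Q\<close>, the product is 0 whatever the other norm is, since
      \<open>0 * \<infinity> = 0\<close>. This leaves only the intervals that meet both supports.\<close>
    consider "\<forall>x\<in>Q. u x = 0" | "\<forall>x\<in>Q. \<sigma> x = 0"
      | x y where "x \<in> Q" "u x \<noteq> 0" "y \<in> Q" "\<sigma> y \<noteq> 0"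
      by blast
    then show ?thesis
    proof cases
      case 1
      then have "luxemburg_norm A Q (\<lambda>x. sqrt (u x)) = 0" "avg_L2_norm Q (\<lambda>x. sqrt (u x)) = 0"
        using A[of 0] by (auto intro!: luxemburg_norm_zero avg_L2_norm_zero)
      then show ?thesis by simp
    next
      case 2
      then have "luxemburg_norm B Q (\<lambda>x. sqrt (\<sigma> x)) = 0" "avg_L2_norm Q (\<lambda>x. sqrt (\<sigma> x)) = 0"
        using B[of 0] by (auto intro!: luxemburg_norm_zero avg_L2_norm_zero)
      then show ?thesis by simp
    next
      case 3
      then obtain i j where ij: "2 \<le> i" "x \<in> I i" "2 \<le> j" "y \<in> J j"
        using u_supp \<sigma>_supp by blast
      obtain a r M where a0: "0 < a" and r1: "1 \<le> r" and C: "a * ln (exp 1 + r) / r \<le> 12"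
        and finM: "finite M" and M: "M = {n. 2 \<le> n \<and> Q \<inter> block n \<noteq> {}}"
        and Ka: "\<And>n. n \<in> M \<Longrightarrow> K n \<le> a\<^sup>2"
        and smallI: "emeasure lborel (Q \<inter> (\<Union>n\<in>M. I n)) \<le> ennreal (measure lborel Q / r)"
        and smallJ: "emeasure lborel (Q \<inter> (\<Union>n\<in>M. J n)) \<le> ennreal (measure lborel Q / r)"
        using interval_parameters[OF K I J Q, of i x j y] 3 ij by blast
      define E where "E = Q \<inter> (\<Union>n\<in>M. I n)"
      define F where "F = Q \<inter> (\<Union>n\<in>M. J n)"
      have E: "E \<in> sets lborel" and F: "F \<in> sets lborel"
        using finM bounded_interval_sets[OF Q] unfolding E_def F_def
        by (auto simp: M I J intro!: sets.finite_UN)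
      have u_le: "\<bar>sqrt (u x)\<bar> \<le> a * indicator E x" if "x \<in> Q" for x
      proof (cases "u x = 0")
        case False
        then obtain n where n: "2 \<le> n" "x \<in> I n"
          using u_supp by blast
        then have "n \<in> M"
          using I_block that by (auto simp: M)
        then have "\<bar>sqrt (u x)\<bar> \<le> a"
          using K_bounds(1)[OF K n(1)] Ka[of n] a0 by (simp add: u_val[OF n] real_le_lsqrt)
        moreover have "x \<in> E"
          using n \<open>n \<in> M\<close> that by (auto simp: E_def)
        ultimately show ?thesis by simp
      qed (use a0 in auto)
      have \<sigma>_le: "\<bar>sqrt (\<sigma> x)\<bar> \<le> 1 * indicator F x" if "x \<in> Q" for x
      proof (cases "\<sigma> x = 0")
        case False
        then obtain n where n: "2 \<le> n" "x \<in> J n"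
          using \<sigma>_supp by blast
        then have "n \<in> M"
          using J_block that by (auto simp: M)
        then have "x \<in> F"
          using n that by (auto simp: F_def)
        then show ?thesis by (simp add: \<sigma>_val[OF n])
      qed auto
      have L0: "0 \<le> ln (exp 1 + r)"
        using ln_exp1_add_ge_1[of r] r1 by simp
      have "luxemburg_norm A Q (\<lambda>x. sqrt (u x)) \<le> ennreal (a * ln (exp 1 + r) / sqrt r)"
        using smallI by (intro luxemburg_norm_log_bump_le[OF A Q E a0 r1 u_le]) (auto simp: E_def)
      moreover have "avg_L2_norm Q (\<lambda>x. sqrt (\<sigma> x)) \<le> ennreal (1 / sqrt r)"
        using smallJ r1 by (intro avg_L2_norm_le[OF Q F _ _ \<sigma>_le]) (auto simp: F_def)
      moreover have "avg_L2_norm Q (\<lambda>x. sqrt (u x)) \<le> ennreal (a / sqrt r)"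
        using smallI a0 r1 by (intro avg_L2_norm_le[OF Q E _ _ u_le]) (auto simp: E_def)
      moreover have "luxemburg_norm B Q (\<lambda>x. sqrt (\<sigma> x)) \<le> ennreal (1 * ln (exp 1 + r) / sqrt r)"
        using smallJ by (intro luxemburg_norm_log_bump_le[OF B Q F _ r1 \<sigma>_le]) (auto simp: F_def)
      moreover have "ennreal (a * ln (exp 1 + r) / sqrt r) * ennreal (1 / sqrt r) \<le> ennreal 12"
        "ennreal (a / sqrt r) * ennreal (1 * ln (exp 1 + r) / sqrt r) \<le> ennreal 12"
        using C a0 r1 L0 by (simp_all add: ennreal_mult[symmetric] ennreal_leI del: ennreal_numeral)
      ultimately show ?thesis
        by (meson mult_mono order_trans zero_le)
    qed
  qed
  have large: "ennreal (sqrt (ln (exp 1 + real n)) / 64)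
      \<le> luxemburg_norm A (block n) (\<lambda>x. sqrt (u x)) * luxemburg_norm B (block n) (\<lambda>x. sqrt (\<sigma> x))"
    and block_interval: "block n \<in> bounded_intervals" if n: "2 \<le> n" for n
  proof -
    define L where "L = ln (exp 1 + real n)"
    have L1: "1 \<le> L"
      by (simp add: L_def ln_exp1_add_ge_1)
    have meas: "measure lborel (block n) = real n"
      by (simp add: block_def)
    show Q: "block n \<in> bounded_intervals"
      using n meas by (auto simp: bounded_intervals_def block_def is_interval_oo)
    have "K n = (real n)\<^sup>2 / L ^ 3"
      using K[OF n] by (simp add: L_def power_int_minus divide_inverse)
    then have sqrtK: "sqrt (K n) = real n / (L * sqrt L)"
      using L1 by (simp add: real_sqrt_divide power3_eq_cube real_sqrt_mult)
    define \<alpha> where "\<alpha> = sqrt (K n) * L / (8 * sqrt (real n))"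
    define \<beta> where "\<beta> = 1 * L / (8 * sqrt (real n))"
    have nonneg: "0 \<le> \<alpha>" "0 \<le> \<beta>"
      using L1 K_bounds(1)[OF K n] by (auto simp: \<alpha>_def \<beta>_def)
    have "\<alpha> * \<beta> = sqrt (K n) * L\<^sup>2 / (64 * real n)"
      by (simp add: \<alpha>_def \<beta>_def power2_eq_square)
    also have "\<dots> = L / sqrt L / 64"
      using n L1 by (simp add: sqrtK power2_eq_square)
    also have "\<dots> = sqrt L / 64"
      using L1 by (simp add: real_div_sqrt)
    finally have "\<alpha> * \<beta> = sqrt L / 64" .
    then have "ennreal (sqrt L / 64) = ennreal \<alpha> * ennreal \<beta>"
      using ennreal_mult[OF nonneg] by (simp only:)
    moreover have "ennreal \<alpha> \<le> luxemburg_norm A (block n) (\<lambda>x. sqrt (u x))"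
      using luxemburg_norm_log_bump_ge[OF A Q, of "I n" "sqrt (K n)" "\<lambda>x. sqrt (u x)"]
        n I_block[OF n] u_val[OF n] K_bounds(1)[OF K n]
      by (simp add: meas L_def I \<alpha>_def)
    moreover have "ennreal \<beta> \<le> luxemburg_norm B (block n) (\<lambda>x. sqrt (\<sigma> x))"
      using luxemburg_norm_log_bump_ge[OF B Q, of "J n" 1 "\<lambda>x. sqrt (\<sigma> x)"]
        n J_block[OF n] \<sigma>_val[OF n]
      by (simp add: meas L_def J \<beta>_def)
    ultimately show "ennreal (sqrt (ln (exp 1 + real n)) / 64)
      \<le> luxemburg_norm A (block n) (\<lambda>x. sqrt (u x)) * luxemburg_norm B (block n) (\<lambda>x. sqrt (\<sigma> x))"
      unfolding L_def by (simp only: mult_mono zero_le)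
  qed
  show ?thesis
  proof (intro conjI)
    show "(SUP Q\<in>bounded_intervals.
        luxemburg_norm A Q (\<lambda>x. sqrt (u x)) * avg_L2_norm Q (\<lambda>x. sqrt (\<sigma> x))) < \<infinity>"
      using bounds by (intro le_less_trans[OF SUP_least, of _ _ "ennreal 12"]) auto
    show "(SUP Q\<in>bounded_intervals.
        avg_L2_norm Q (\<lambda>x. sqrt (u x)) * luxemburg_norm B Q (\<lambda>x. sqrt (\<sigma> x))) < \<infinity>"
      using bounds by (intro le_less_trans[OF SUP_least, of _ _ "ennreal 12"]) auto
    let ?S = "SUP Q\<in>bounded_intervals.
        luxemburg_norm A Q (\<lambda>x. sqrt (u x)) * luxemburg_norm B Q (\<lambda>x. sqrt (\<sigma> x))"
    show "?S = \<infinity>"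
    proof (rule ccontr)
      assume "?S \<noteq> \<infinity>"
      then obtain c where c: "0 \<le> c" "?S = ennreal c"
        by (cases ?S) auto
      obtain n where n: "exp ((64 * (c + 1))\<^sup>2) + 2 \<le> real n"
        using real_arch_simple by blast
      have pos: "0 < exp ((64 * (c + 1))\<^sup>2)" "(0::real) < exp 1"
        by simp_all
      then have n2: "2 \<le> n"
        using n by linarith
      have "exp ((64 * (c + 1))\<^sup>2) \<le> exp 1 + real n" "0 < exp 1 + real n"
        using n pos by linarith+
      then have "(64 * (c + 1))\<^sup>2 \<le> ln (exp 1 + real n)"
        by (simp add: ln_ge_iff)
      then have "64 * (c + 1) \<le> sqrt (ln (exp 1 + real n))"
        by (rule real_le_rsqrt)
      then have cn: "c < sqrt (ln (exp 1 + real n)) / 64"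
        by simp
      have "ennreal (sqrt (ln (exp 1 + real n)) / 64) \<le> ?S"
        using large[OF n2] block_interval[OF n2] by (rule SUP_upper2[rotated])
      then show False
        using cn c by (simp add: ennreal_le_iff)
    qed
  qed
qed

end
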